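(* For every integer $n\ge 0$, $$b_{n+1}=\sum_{i+j=n}\binom{n+1}{i}\binom{n+1}{j}\,b_i\,b_j,$$ where the sum is over pairs of non-negative integers $(i,j)$ with $i+j=n$ and $b_k$ denotes the number of complete non-ambiguous trees with $k$ internal vertices.
   Context: $\mathbb{N}=\{0,1,2,\dots\}$. For a point $p\in\mathbb{N}\times\mathbb{N}$ write $p=(X(p),Y(p))$. A row is a set of points with fixed $X$, a column a set of points with fixed $Y$. A non-ambiguous tree of size $n$ is a set $A$ of $n$ points of $\mathbb{N}\times\mathbb{N}$ such that: (1) $(0,0)\in A$ (the root); (2) for each non-root $p\in A$, exactly one of the following holds: there is $q\in A$ with $X(q)=X(p)$, $Y(q)<Y(p)$; there is $r\in A$ with $Y(r)=Y(p)$, $X(r)<X(p)$; (3) if some $p\in A$ has $X(p)=x$ (resp. $Y(p)=y$), then for every $0\le x'<x$ (resp. $0\le y'<y$) some $q\in A$ has $X(q)=x'$ (resp. $Y(q)=y'$). $A$ has a binary tree structure with root $(0,0)$: the parent of a non-root $p$ is the nearest point of $A$ preceding $p$ in its row (then $p$ is a right child) or in its column (then $p$ is a left child). A non-ambiguous tree is complete if each of its vertices has either $0$ or $2$ children; vertices with $2$ children are internal. *)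

theory Defs
  imports Complex_Main
begin

text \<open>A point \<open>p\<close> of \<open>\<nat> \<times> \<nat>\<close> has coordinates \<open>X(p) = fst p\<close> and \<open>Y(p) = snd p\<close>;
  a row fixes the first coordinate, a column the second. The size of a tree is its cardinality,
  so "a set of \<open>n\<close> points" for some \<open>n\<close> becomes finiteness.\<close>

definition non_ambiguous_tree :: "(nat \<times> nat) set \<Rightarrow> bool" where
  "non_ambiguous_tree A \<longleftrightarrow>
     finite A \<and>
     (0, 0) \<in> A \<and>
     (\<forall>p\<in>A. p \<noteq> (0, 0) \<longrightarrow>
        ((\<exists>q\<in>A. fst q = fst p \<and> snd q < snd p) \<noteq>
         (\<exists>r\<in>A. snd r = snd p \<and> fst r < fst p))) \<and>
     (\<forall>p\<in>A. \<forall>x'<fst p. \<exists>q\<in>A. fst q = x') \<and>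
     (\<forall>p\<in>A. \<forall>y'<snd p. \<exists>q\<in>A. snd q = y')"

text \<open>\<open>q\<close> is the parent of \<open>p\<close> when it is the nearest point of \<open>A\<close> preceding \<open>p\<close> in its row
  (\<open>p\<close> is then a right child) or in its column (\<open>p\<close> is then a left child). The root \<open>(0, 0)\<close>
  has no preceding point, hence no parent.\<close>

definition is_right_child :: "(nat \<times> nat) set \<Rightarrow> nat \<times> nat \<Rightarrow> nat \<times> nat \<Rightarrow> bool" where
  "is_right_child A q p \<longleftrightarrow>
     q \<in> A \<and> p \<in> A \<and> fst q = fst p \<and> snd q < snd p \<and>
     (\<forall>s\<in>A. fst s = fst p \<and> snd s < snd p \<longrightarrow> snd s \<le> snd q)"

definition is_left_child :: "(nat \<times> nat) set \<Rightarrow> nat \<times> nat \<Rightarrow> nat \<times> nat \<Rightarrow> bool" where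
  "is_left_child A q p \<longleftrightarrow>
     q \<in> A \<and> p \<in> A \<and> snd q = snd p \<and> fst q < fst p \<and>
     (\<forall>s\<in>A. snd s = snd p \<and> fst s < fst p \<longrightarrow> fst s \<le> fst q)"

definition children :: "(nat \<times> nat) set \<Rightarrow> nat \<times> nat \<Rightarrow> (nat \<times> nat) set" where
  "children A q = {p. is_left_child A q p \<or> is_right_child A q p}"

definition complete_non_ambiguous_tree :: "(nat \<times> nat) set \<Rightarrow> bool" where
  "complete_non_ambiguous_tree A \<longleftrightarrow>
     non_ambiguous_tree A \<and> (\<forall>q\<in>A. card (children A q) = 0 \<or> card (children A q) = 2)"

definition internal_vertices :: "(nat \<times> nat) set \<Rightarrow> (nat \<times> nat) set" where
  "internal_vertices A = {q \<in> A. card (children A q) = 2}"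

text \<open>The set counted here is finite: a complete tree with \<open>k\<close> internal vertices has
  \<open>2 * k + 1\<close> points, and since it leaves no row or column empty below its largest
  coordinates, it lies in \<open>{..2 * k} \<times> {..2 * k}\<close>.\<close>

definition b :: "nat \<Rightarrow> nat" where
  "b k = card {A. complete_non_ambiguous_tree A \<and> card (internal_vertices A) = k}"

end

theory Submission
  imports Defs "HOL-Library.Infinite_Set"
begin

text \<open>In a complete tree every vertex with a successor in its row also has one in its column, and
  double counting shows that \<open>k\<close> internal vertices occupy \<open>k + 1\<close> rows and \<open>k + 1\<close> columns. Remove
  the root of a tree with \<open>n + 1\<close> internal vertices: the left subtree, with \<open>i\<close> internal vertices,
  uses the root column, \<open>i + 1\<close> of the \<open>n + 1\<close> other rows and \<open>i\<close> of the \<open>n + 1\<close> other columns; the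
  right subtree, with \<open>j = n - i\<close> internal vertices, uses the root row and everything that is left.
  Conversely any two trees on such lines can be glued, and the number of trees on given sets of rows
  and columns depends only on the sizes of these sets. The choices of lines contribute
  \<open>(n + 1 choose (i + 1)) * (n + 1 choose i)\<close>, where the first factor is \<open>n + 1 choose j\<close>.\<close>

section \<open>Neighbours along a line, and trees with an arbitrary root\<close>

definition row_pred :: "(nat \<times> nat) set \<Rightarrow> nat \<Rightarrow> nat \<Rightarrow> bool" where
  "row_pred A x y \<longleftrightarrow> (\<exists>y'<y. (x, y') \<in> A)"

definition col_pred :: "(nat \<times> nat) set \<Rightarrow> nat \<Rightarrow> nat \<Rightarrow> bool" where
  "col_pred A x y \<longleftrightarrow> (\<exists>x'<x. (x', y) \<in> A)"

definition row_succ :: "(nat \<times> nat) set \<Rightarrow> nat \<Rightarrow> nat \<Rightarrow> bool" where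
  "row_succ A x y \<longleftrightarrow> (\<exists>y'>y. (x, y') \<in> A)"

definition col_succ :: "(nat \<times> nat) set \<Rightarrow> nat \<Rightarrow> nat \<Rightarrow> bool" where
  "col_succ A x y \<longleftrightarrow> (\<exists>x'>x. (x', y) \<in> A)"

text \<open>Complete trees with root \<open>(r, c)\<close>, without the condition that no row or column is left empty,
  so that subtrees are trees without relabelling.\<close>

definition ctree :: "nat \<Rightarrow> nat \<Rightarrow> (nat \<times> nat) set \<Rightarrow> bool" where
  "ctree r c A \<longleftrightarrow>
     finite A \<and> (r, c) \<in> A \<and>
     (\<forall>x y. (x, y) \<in> A \<longrightarrow> r \<le> x \<and> c \<le> y) \<and>
     (\<forall>x y. (x, y) \<in> A \<longrightarrow> (x, y) \<noteq> (r, c) \<longrightarrow> row_pred A x y \<noteq> col_pred A x y) \<and>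
     (\<forall>x y. (x, y) \<in> A \<longrightarrow> row_succ A x y = col_succ A x y)"

lemma ctreeD:
  assumes "ctree r c A"
  shows "finite A" "(r, c) \<in> A"
    "\<And>x y. (x, y) \<in> A \<Longrightarrow> r \<le> x" "\<And>x y. (x, y) \<in> A \<Longrightarrow> c \<le> y"
    "\<And>x y. (x, y) \<in> A \<Longrightarrow> (x, y) \<noteq> (r, c) \<Longrightarrow> row_pred A x y \<noteq> col_pred A x y"
    "\<And>x y. (x, y) \<in> A \<Longrightarrow> row_succ A x y = col_succ A x y"
  using assms unfolding ctree_def by blast+

text \<open>The root may stay existential: its coordinates are forced to be the minima of
  \<open>R\<close> and \<open>C\<close>.\<close>

definition ctrees :: "nat set \<Rightarrow> nat set \<Rightarrow> (nat \<times> nat) set set" where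
  "ctrees R C = {A. (\<exists>r c. ctree r c A) \<and> fst ` A = R \<and> snd ` A = C}"

lemma finite_ctrees: "finite R \<Longrightarrow> finite C \<Longrightarrow> finite (ctrees R C)"
  by (rule finite_subset[of _ "Pow (R \<times> C)"]) (force simp: ctrees_def)+

lemma row_pred_swap: "row_pred (prod.swap ` A) x y = col_pred A y x"
  and col_pred_swap: "col_pred (prod.swap ` A) x y = row_pred A y x"
  and row_succ_swap: "row_succ (prod.swap ` A) x y = col_succ A y x"
  and col_succ_swap: "col_succ (prod.swap ` A) x y = row_succ A y x"
  unfolding row_pred_def col_pred_def row_succ_def col_succ_def by force+

text \<open>The conditions are symmetric in rows and columns, so facts about left subtrees transfer
  to right ones.\<close>

lemma ctree_swap:
  assumes "ctree r c A" shows "ctree c r (prod.swap ` A)"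
proof -
  have "(x, y) \<in> prod.swap ` A \<longleftrightarrow> (y, x) \<in> A" for x y
    by force
  then show ?thesis
    using assms unfolding ctree_def row_pred_swap col_pred_swap row_succ_swap col_succ_swap
    by auto
qed

subsection \<open>Translating the definitions\<close>

text \<open>The first point after \<open>(x, y)\<close> in its row has \<open>(x, y)\<close> as its
  nearest predecessor, so the nearness condition disappears once only existence of a child
  matters.\<close>

lemma ex_right_child_iff:
  assumes "(x, y) \<in> A"
  shows "(\<exists>p. is_right_child A (x, y) p) \<longleftrightarrow> row_succ A x y"
proof
  assume "\<exists>p. is_right_child A (x, y) p"
  then show "row_succ A x y" by (auto simp: is_right_child_def row_succ_def)
next
  assume "row_succ A x y"
  let ?P = "\<lambda>y'. y < y' \<and> (x, y') \<in> A"
  obtain y0 where "y < y0 \<and> (x, y0) \<in> A"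
    using \<open>row_succ A x y\<close> by (auto simp: row_succ_def)
  then have "?P (Least ?P)" by (rule LeastI)
  moreover have "Least ?P \<le> z" if "?P z" for z using that by (rule Least_le)
  ultimately have "is_right_child A (x, y) (x, LEAST y'. ?P y')"
    using assms unfolding is_right_child_def by (auto simp: not_less[symmetric])
  then show "\<exists>p. is_right_child A (x, y) p" ..
qed

lemma ex_left_child_iff:
  assumes "(x, y) \<in> A"
  shows "(\<exists>p. is_left_child A (x, y) p) \<longleftrightarrow> col_succ A x y"
proof
  assume "\<exists>p. is_left_child A (x, y) p"
  then show "col_succ A x y" by (auto simp: is_left_child_def col_succ_def)
next
  assume "col_succ A x y"
  let ?P = "\<lambda>x'. x < x' \<and> (x', y) \<in> A"
  obtain x0 where "x < x0 \<and> (x0, y) \<in> A"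
    using \<open>col_succ A x y\<close> by (auto simp: col_succ_def)
  then have "?P (Least ?P)" by (rule LeastI)
  moreover have "Least ?P \<le> z" if "?P z" for z using that by (rule Least_le)
  ultimately have "is_left_child A (x, y) (LEAST x'. ?P x', y)"
    using assms unfolding is_left_child_def by (auto simp: not_less[symmetric])
  then show "\<exists>p. is_left_child A (x, y) p" ..
qed

lemma right_child_unique: "is_right_child A q p \<Longrightarrow> is_right_child A q p' \<Longrightarrow> p = p'"
  unfolding is_right_child_def by (metis linorder_neqE_nat not_le prod_eqI)

lemma left_child_unique: "is_left_child A q p \<Longrightarrow> is_left_child A q p' \<Longrightarrow> p = p'"
  unfolding is_left_child_def by (metis linorder_neqE_nat not_le prod_eqI)

text \<open>There is at most one child of each kind, and no point is both, since one kind keeps the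
  row and the other the column. Having 0 or 2 children thus means that the two indicators
  agree.\<close>

lemma card_children:
  assumes "finite A" "(x, y) \<in> A"
  shows "card (children A (x, y)) = of_bool (col_succ A x y) + of_bool (row_succ A x y)"
proof -
  let ?L = "{p. is_left_child A (x, y) p}" and ?R = "{p. is_right_child A (x, y) p}"
  have L: "card ?L = of_bool (col_succ A x y)"
  proof (cases "col_succ A x y")
    case True
    then obtain p where "is_left_child A (x, y) p" using ex_left_child_iff[OF assms(2)] by blast
    then have "?L = {p}" using left_child_unique by blast
    then show ?thesis using True by simp
  next
    case False
    then have empty: "?L = {}" using ex_left_child_iff[OF assms(2)] by blast
    show ?thesis unfolding empty using False by simp
  qed
  have R: "card ?R = of_bool (row_succ A x y)"
  proof (cases "row_succ A x y")
    case True
    then obtain p where "is_right_child A (x, y) p" using ex_right_child_iff[OF assms(2)] by blast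
    then have "?R = {p}" using right_child_unique by blast
    then show ?thesis using True by simp
  next
    case False
    then have empty: "?R = {}" using ex_right_child_iff[OF assms(2)] by blast
    show ?thesis unfolding empty using False by simp
  qed
  have "?L \<inter> ?R = {}" by (auto simp: is_left_child_def is_right_child_def)
  moreover have "finite ?L" "finite ?R"
    by (rule finite_subset[OF _ assms(1)], auto simp: is_left_child_def is_right_child_def)+
  ultimately have "card (?L \<union> ?R) = card ?L + card ?R" by (intro card_Un_disjoint)
  moreover have "children A (x, y) = ?L \<union> ?R" by (auto simp: children_def)
  ultimately show ?thesis using L R by simp
qed

text \<open>For the root \<open>(0, 0)\<close> the lower bounds in \<open>ctree\<close> are vacuous;
  condition (3), which \<open>ctree\<close> leaves out, becomes downward closure of the two
  projections.\<close>

lemma complete_non_ambiguous_tree_iff: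
  "complete_non_ambiguous_tree A \<longleftrightarrow>
     ctree 0 0 A \<and> (\<forall>x\<in>fst ` A. {..<x} \<subseteq> fst ` A) \<and> (\<forall>y\<in>snd ` A. {..<y} \<subseteq> snd ` A)"
proof (cases "finite A")
  case True
  have row: "(\<exists>q\<in>A. fst q = x \<and> snd q < y) \<longleftrightarrow> row_pred A x y"
    and col: "(\<exists>q\<in>A. snd q = y \<and> fst q < x) \<longleftrightarrow> col_pred A x y" for x y
    by (force simp: row_pred_def col_pred_def)+
  have "(\<exists>q\<in>A. fst q = z) \<longleftrightarrow> z \<in> fst ` A" "(\<exists>q\<in>A. snd q = z) \<longleftrightarrow> z \<in> snd ` A" for z
    by auto
  then have down: "(\<forall>p\<in>A. \<forall>x'<fst p. \<exists>q\<in>A. fst q = x') \<longleftrightarrow> (\<forall>x\<in>fst ` A. {..<x} \<subseteq> fst ` A)"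
    "(\<forall>p\<in>A. \<forall>y'<snd p. \<exists>q\<in>A. snd q = y') \<longleftrightarrow> (\<forall>y\<in>snd ` A. {..<y} \<subseteq> snd ` A)"
    by auto
  have compl: "(\<forall>q\<in>A. card (children A q) = 0 \<or> card (children A q) = 2) \<longleftrightarrow>
    (\<forall>x y. (x, y) \<in> A \<longrightarrow> row_succ A x y = col_succ A x y)"
  proof -
    have "card (children A (x, y)) = 0 \<or> card (children A (x, y)) = 2 \<longleftrightarrow>
        row_succ A x y = col_succ A x y" if "(x, y) \<in> A" for x y
      using card_children[OF True that] by (cases "row_succ A x y"; cases "col_succ A x y") simp_all
    then show ?thesis by (metis prod.collapse)
  qed
  have cond2: "(\<forall>p\<in>A. p \<noteq> (0, 0) \<longrightarrow>
        ((\<exists>q\<in>A. fst q = fst p \<and> snd q < snd p) \<noteq>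
         (\<exists>r\<in>A. snd r = snd p \<and> fst r < fst p))) \<longleftrightarrow>
    (\<forall>x y. (x, y) \<in> A \<longrightarrow> (x, y) \<noteq> (0, 0) \<longrightarrow> row_pred A x y \<noteq> col_pred A x y)"
    unfolding row col by auto
  show ?thesis
    unfolding complete_non_ambiguous_tree_def non_ambiguous_tree_def ctree_def compl cond2 down
    by auto
qed (auto simp: complete_non_ambiguous_tree_def non_ambiguous_tree_def ctree_def)

subsection \<open>Numbers of rows and columns\<close>

text \<open>Each nonempty fibre of \<open>f\<close> has a unique point with largest
  \<open>g\<close>, by injectivity of the pair. For the two coordinates these are the last points of
  the rows or columns.\<close>

lemma card_maximal_in_fibres:
  fixes f g :: "'a \<Rightarrow> nat"
  assumes "finite A" "inj_on (\<lambda>p. (f p, g p)) A"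
  shows "card {p \<in> A. \<not> (\<exists>q\<in>A. f q = f p \<and> g p < g q)} = card (f ` A)"
proof (rule bij_betw_same_card[of f], unfold bij_betw_def, intro conjI)
  let ?M = "{p \<in> A. \<not> (\<exists>q\<in>A. f q = f p \<and> g p < g q)}"
  show "inj_on f ?M"
  proof (rule inj_onI)
    fix p q assume "p \<in> ?M" "q \<in> ?M" "f p = f q"
    then have "g p = g q" "p \<in> A" "q \<in> A" by (auto intro: le_antisym simp: not_less)
    then show "p = q" using \<open>f p = f q\<close> inj_onD[OF assms(2), of p q] by simp
  qed
  have "f p \<in> f ` ?M" if "p \<in> A" for p
  proof -
    let ?F = "{q \<in> A. f q = f p}"
    have "finite (g ` ?F)" "g ` ?F \<noteq> {}" using assms(1) that by auto
    then have "Max (g ` ?F) \<in> g ` ?F" by (rule Max_in)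
    then obtain q where q: "q \<in> A" "f q = f p" "g q = Max (g ` ?F)" by force
    have "g s \<le> g q" if "s \<in> A" "f s = f q" for s
      unfolding q(3) using that q(2) \<open>finite (g ` ?F)\<close> by (intro Max_ge) auto
    then have "q \<in> ?M" using q(1) by (auto simp: not_less)
    then show ?thesis unfolding q(2)[symmetric] by (rule imageI)
  qed
  then show "f ` ?M = f ` A" by blast
qed

text \<open>The order dual, for the first points of rows or columns.\<close>

lemma card_minimal_in_fibres:
  fixes f g :: "'a \<Rightarrow> nat"
  assumes "finite A" "inj_on (\<lambda>p. (f p, g p)) A"
  shows "card {p \<in> A. \<not> (\<exists>q\<in>A. f q = f p \<and> g q < g p)} = card (f ` A)"
proof (rule bij_betw_same_card[of f], unfold bij_betw_def, intro conjI)
  let ?M = "{p \<in> A. \<not> (\<exists>q\<in>A. f q = f p \<and> g q < g p)}"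
  show "inj_on f ?M"
  proof (rule inj_onI)
    fix p q assume "p \<in> ?M" "q \<in> ?M" "f p = f q"
    then have "g p = g q" "p \<in> A" "q \<in> A" by (auto intro: le_antisym simp: not_less)
    then show "p = q" using \<open>f p = f q\<close> inj_onD[OF assms(2), of p q] by simp
  qed
  have "f p \<in> f ` ?M" if "p \<in> A" for p
  proof -
    let ?F = "{q \<in> A. f q = f p}"
    have "finite (g ` ?F)" "g ` ?F \<noteq> {}" using assms(1) that by auto
    then have "Min (g ` ?F) \<in> g ` ?F" by (rule Min_in)
    then obtain q where q: "q \<in> A" "f q = f p" "g q = Min (g ` ?F)" by force
    have "g q \<le> g s" if "s \<in> A" "f s = f q" for s
      unfolding q(3) using that q(2) \<open>finite (g ` ?F)\<close> by (intro Min_le) auto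
    then have "q \<in> ?M" using q(1) by (auto simp: not_less)
    then show ?thesis unfolding q(2)[symmetric] by (rule imageI)
  qed
  then show "f ` ?M = f ` A" by blast
qed

text \<open>Every row has one point without predecessor and one without successor, so the points with
  a predecessor in their row are as many as those with a successor, namely \<open>|A| - |rows|\<close>;
  the same holds for columns. Each vertex other than the root has exactly one kind of predecessor.\<close>

lemma ctree_card:
  assumes "ctree r c A"
  defines "k \<equiv> card {(x, y) \<in> A. row_succ A x y}"
  shows "card (fst ` A) = Suc k" "card (snd ` A) = Suc k"
proof -
  note T = ctreeD[OF assms(1)]
  let ?rp = "{(x, y) \<in> A. row_pred A x y}" and ?cp = "{(x, y) \<in> A. col_pred A x y}"
  let ?rs = "{(x, y) \<in> A. row_succ A x y}" and ?cs = "{(x, y) \<in> A. col_succ A x y}"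
  have inj: "inj_on (\<lambda>p. (fst p, snd p)) A" "inj_on (\<lambda>p. (snd p, fst p)) A"
    by (auto simp: inj_on_def)
  have compl: "card B + card (A - B) = card A" if "B \<subseteq> A" for B
    using that T(1) by (metis card_Diff_subset card_mono finite_subset le_add_diff_inverse)
  have "card (A - ?rp) = card (fst ` A)"
    unfolding card_minimal_in_fibres[OF T(1) inj(1), symmetric]
    by (rule arg_cong[of _ _ card]) (force simp: row_pred_def)
  moreover have "card (A - ?cp) = card (snd ` A)"
    unfolding card_minimal_in_fibres[OF T(1) inj(2), symmetric]
    by (rule arg_cong[of _ _ card]) (force simp: col_pred_def)
  moreover have "card (A - ?rs) = card (fst ` A)"
    unfolding card_maximal_in_fibres[OF T(1) inj(1), symmetric]
    by (rule arg_cong[of _ _ card]) (force simp: row_succ_def)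
  moreover have "card (A - ?cs) = card (snd ` A)"
    unfolding card_maximal_in_fibres[OF T(1) inj(2), symmetric]
    by (rule arg_cong[of _ _ card]) (force simp: col_succ_def)
  moreover have "card ?rs = card ?cs" using T(6) by (intro arg_cong[of _ _ card]) auto
  moreover have "card ?rp + card ?cp + 1 = card A"
  proof -
    have "\<not> row_pred A r c" "\<not> col_pred A r c"
      using T(3,4) by (force simp: row_pred_def col_pred_def)+
    then have pred: "?rp \<inter> ?cp = {}" "?rp \<union> ?cp = A - {(r, c)}" using T(5) by auto
    have "finite ?rp" "finite ?cp" by (rule finite_subset[OF _ T(1)], blast)+
    then have "card ?rp + card ?cp = card (A - {(r, c)})"
      unfolding pred(2)[symmetric] using pred(1) by (rule card_Un_disjoint[symmetric])
    then show ?thesis using T(1,2) by (metis Suc_eq_plus1 card_Suc_Diff1)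
  qed
  moreover have "card ?rp + card (A - ?rp) = card A" "card ?cp + card (A - ?cp) = card A"
    "card ?rs + card (A - ?rs) = card A" "card ?cs + card (A - ?cs) = card A"
    by (rule compl, blast)+
  \<comment> \<open>All four sets of points with a neighbour of a given kind have size
    \<open>k\<close>. Hence \<open>card A = 2 * k + 1\<close>, and there are
    \<open>card A - k\<close> rows and as many columns.\<close>
  ultimately show "card (fst ` A) = Suc k" "card (snd ` A) = Suc k"
    unfolding k_def by linarith+
qed

text \<open>Both sizes exceed the number of internal vertices by one. This removes the unbalanced
  choices of lines from the final sum.\<close>

lemma ctrees_card_eq:
  assumes "A \<in> ctrees R C"
  shows "card R = card C" "0 < card R"
  using assms ctree_card by (fastforce simp: ctrees_def)+

lemma downward_closed_eq_atMost:
  fixes S :: "nat set"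
  assumes "card S = Suc k" "\<forall>x\<in>S. {..<x} \<subseteq> S"
  shows "S = {..k}"
proof -
  have fin: "finite S" using assms(1) by (simp add: card_ge_0_finite)
  have "S \<noteq> {}" using assms(1) by auto
  then have "Max S \<in> S" by (rule Max_in[OF fin])
  moreover from this have "{..<Max S} \<subseteq> S" using assms(2) by blast
  ultimately have "S = {..Max S}"
    using Max_ge[OF fin] by (auto simp: le_less subset_eq)
  then show ?thesis using assms(1) by (metis card_atMost nat.inject)
qed

text \<open>By the line count and condition (3) the occupied lines are exactly \<open>0\<close> to
  \<open>k\<close>. Conversely, these line sets force the root \<open>(0, 0)\<close> and
  \<open>k\<close> internal vertices.\<close>

lemma b_eq_card_ctrees: "b k = card (ctrees {..k} {..k})"
proof -
  have int: "internal_vertices A = {(x, y) \<in> A. row_succ A x y}" if "ctree 0 0 A" for A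
    using card_children[of A] ctreeD(1,6)[OF that]
    by (fastforce simp: internal_vertices_def split: if_splits)
  have "{A. complete_non_ambiguous_tree A \<and> card (internal_vertices A) = k} =
    ctrees {..k} {..k}" (is "?L = ?R")
  proof (intro equalityI subsetI)
    fix A assume "A \<in> ?L"
    then have A: "ctree 0 0 A" "\<forall>x\<in>fst ` A. {..<x} \<subseteq> fst ` A" "\<forall>y\<in>snd ` A. {..<y} \<subseteq> snd ` A"
      and k: "card {(x, y) \<in> A. row_succ A x y} = k"
      using int complete_non_ambiguous_tree_iff by auto
    have "fst ` A = {..k}" "snd ` A = {..k}"
      using ctree_card[OF A(1)] k A downward_closed_eq_atMost by metis+
    then show "A \<in> ?R" using A(1) by (auto simp: ctrees_def)
  next
    fix A assume "A \<in> ?R"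
    then obtain r c where A: "ctree r c A" and im: "fst ` A = {..k}" "snd ` A = {..k}"
      by (auto simp: ctrees_def)
    have "0 \<in> fst ` A" "0 \<in> snd ` A" using im by auto
    then have "r = 0" "c = 0" using ctreeD(3,4)[OF A] by force+
    then have A0: "ctree 0 0 A" using A by simp
    have "card (internal_vertices A) = k"
      using ctree_card(1)[OF A] int[OF A0] im by simp
    moreover have "complete_non_ambiguous_tree A"
      unfolding complete_non_ambiguous_tree_iff im using A0 by auto
    ultimately show "A \<in> ?L" by simp
  qed
  then show ?thesis by (simp add: b_def)
qed

subsection \<open>Relabelling rows and columns\<close>

text \<open>The conditions only compare coordinates occurring in \<open>A\<close>, and the
  relabelling preserves these comparisons.\<close>

lemma ctree_relabel:
  assumes T: "ctree r c A"
    and f: "strict_mono_on (fst ` A) f" and g: "strict_mono_on (snd ` A) g"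
  shows "ctree (f r) (g c) (map_prod f g ` A)"
proof -
  note T = ctreeD[OF T]
  have f_eq: "f x = f x' \<longleftrightarrow> x = x'" and f_less: "f x < f x' \<longleftrightarrow> x < x'"
    and f_le: "f x \<le> f x' \<longleftrightarrow> x \<le> x'"
    if "(x, y) \<in> A" "(x', y') \<in> A" for x x' y y'
  proof -
    have "x \<in> fst ` A" "x' \<in> fst ` A" using that by force+
    then show "f x = f x' \<longleftrightarrow> x = x'" "f x < f x' \<longleftrightarrow> x < x'" "f x \<le> f x' \<longleftrightarrow> x \<le> x'"
      using f by (auto simp: strict_mono_on_eq strict_mono_on_less strict_mono_on_less_eq)
  qed
  have g_eq: "g y = g y' \<longleftrightarrow> y = y'" and g_less: "g y < g y' \<longleftrightarrow> y < y'"
    and g_le: "g y \<le> g y' \<longleftrightarrow> y \<le> y'"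
    if "(x, y) \<in> A" "(x', y') \<in> A" for x x' y y'
  proof -
    have "y \<in> snd ` A" "y' \<in> snd ` A" using that by force+
    then show "g y = g y' \<longleftrightarrow> y = y'" "g y < g y' \<longleftrightarrow> y < y'" "g y \<le> g y' \<longleftrightarrow> y \<le> y'"
      using g by (auto simp: strict_mono_on_eq strict_mono_on_less strict_mono_on_less_eq)
  qed
  have img: "(u, v) \<in> map_prod f g ` A \<longleftrightarrow> (\<exists>x y. (x, y) \<in> A \<and> u = f x \<and> v = g y)" for u v
    by force
  have rel: "row_pred (map_prod f g ` A) (f x) (g y) = row_pred A x y"
    "col_pred (map_prod f g ` A) (f x) (g y) = col_pred A x y"
    "row_succ (map_prod f g ` A) (f x) (g y) = row_succ A x y"
    "col_succ (map_prod f g ` A) (f x) (g y) = col_succ A x y" if "(x, y) \<in> A" for x y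
    unfolding row_pred_def col_pred_def row_succ_def col_succ_def img
    using that f_eq[OF that] g_eq[OF that] f_less[OF that] g_less[OF that]
      f_less[OF _ that] g_less[OF _ that]
    by metis+
  have pred: "row_pred (map_prod f g ` A) (f x) (g y) \<noteq> col_pred (map_prod f g ` A) (f x) (g y)"
    if "(x, y) \<in> A" "(f x, g y) \<noteq> (f r, g c)" for x y
    unfolding rel[OF that(1)] using that T(5)[of x y] by auto
  have succ: "row_succ (map_prod f g ` A) (f x) (g y) = col_succ (map_prod f g ` A) (f x) (g y)"
    if "(x, y) \<in> A" for x y
    unfolding rel[OF that] using T(6)[OF that] .
  have le: "f r \<le> f x \<and> g c \<le> g y" if "(x, y) \<in> A" for x y
    using T(3,4)[OF that] f_le[OF T(2) that] g_le[OF T(2) that] by simp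
  show ?thesis
    unfolding ctree_def
  proof (intro conjI allI impI)
    show "finite (map_prod f g ` A)" "(f r, g c) \<in> map_prod f g ` A" using T(1,2) by auto
  next
    fix u v assume "(u, v) \<in> map_prod f g ` A"
    then obtain x y where "(x, y) \<in> A" "u = f x" "v = g y" unfolding img by blast
    then show "f r \<le> u" "g c \<le> v"
      "row_succ (map_prod f g ` A) u v = col_succ (map_prod f g ` A) u v"
      "(u, v) \<noteq> (f r, g c) \<Longrightarrow> row_pred (map_prod f g ` A) u v \<noteq> col_pred (map_prod f g ` A) u v"
      using le succ pred by simp_all
  qed
qed

text \<open>Increasing bijections between the line sets act injectively on trees. The inequality is
  enough, as it can be used in both directions.\<close>

lemma card_ctrees_le:
  assumes fin: "finite R" "finite C" "finite R'" "finite C'"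
    and card: "card R = card R'" "card C = card C'"
  shows "card (ctrees R C) \<le> card (ctrees R' C')"
proof -
  \<comment> \<open>Invert the increasing enumeration of \<open>S\<close> by
    \<open>{..<card S}\<close>, then follow that of \<open>S'\<close>.\<close>
  have iso: "\<exists>f. bij_betw f S S' \<and> strict_mono_on S f"
    if S: "finite S" "finite S'" "card S = card S'" for S S' :: "nat set"
  proof -
    obtain h where h: "bij_betw h {..<card S} S" "strict_mono_on {..<card S} h"
      using ex_bij_betw_strict_mono_card[OF S(1)] by blast
    obtain h' where h': "bij_betw h' {..<card S} S'" "strict_mono_on {..<card S} h'"
      using ex_bij_betw_strict_mono_card[OF S(2)] S(3) by auto
    let ?i = "inv_into {..<card S} h"
    have i: "bij_betw ?i S {..<card S}" by (rule bij_betw_inv_into[OF h(1)])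
    have "?i x < ?i y" if xy: "x \<in> S" "y \<in> S" "x < y" for x y
    proof -
      have "h (?i x) < h (?i y)"
        using xy by (simp add: bij_betw_inv_into_right[OF h(1)])
      then show ?thesis
        using strict_mono_on_less[OF h(2)] bij_betw_apply[OF i] xy by blast
    qed
    then have "strict_mono_on S (h' \<circ> ?i)"
      using bij_betw_apply[OF i] strict_mono_onD[OF h'(2)]
      by (intro strict_mono_onI) (simp del: lessThan_iff)
    moreover have "bij_betw (h' \<circ> ?i) S S'" using i h'(1) by (rule bij_betw_trans)
    ultimately show ?thesis by blast
  qed
  obtain f where f: "bij_betw f R R'" "strict_mono_on R f" using iso fin card by metis
  obtain g where g: "bij_betw g C C'" "strict_mono_on C g" using iso fin card by metis
  have sub: "A \<subseteq> R \<times> C" if "A \<in> ctrees R C" for A using that by (force simp: ctrees_def)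
  show ?thesis
  proof (rule card_inj_on_le[of "image (map_prod f g)"])
    have inj: "inj_on (map_prod f g) (R \<times> C)"
      using f(1) g(1) by (intro map_prod_inj_on) (auto simp: bij_betw_def)
    show "inj_on (image (map_prod f g)) (ctrees R C)"
      using inj_on_image_eq_iff[OF inj sub sub] by (intro inj_onI) blast
    show "image (map_prod f g) ` ctrees R C \<subseteq> ctrees R' C'"
    proof (intro image_subsetI)
      fix A assume "A \<in> ctrees R C"
      then obtain r c where A: "ctree r c A" "fst ` A = R" "snd ` A = C" by (auto simp: ctrees_def)
      have "fst ` map_prod f g ` A = f ` fst ` A" "snd ` map_prod f g ` A = g ` snd ` A"
        by (simp_all add: image_image)
      then show "map_prod f g ` A \<in> ctrees R' C'"
        using ctree_relabel[OF A(1), of f g] A f g by (auto simp: ctrees_def bij_betw_def)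
    qed
    show "finite (ctrees R' C')" using fin by (simp add: finite_ctrees)
  qed
qed

text \<open>The shift by one reflects that \<open>k\<close> internal vertices need
  \<open>k + 1\<close> lines of each kind. The value 0 otherwise allows summation over all subsets
  of lines.\<close>

lemma card_ctrees:
  assumes "finite R" "finite C"
  shows "card (ctrees R C) = (if card R = card C \<and> 0 < card R then b (card R - 1) else 0)"
proof (cases "card R = card C \<and> 0 < card R")
  case True
  let ?K = "{..card R - 1}"
  have "card R = card ?K" "card C = card ?K" using True by auto
  then have "card (ctrees R C) = card (ctrees ?K ?K)"
    using assms by (intro le_antisym card_ctrees_le) auto
  then show ?thesis using True by (simp add: b_eq_card_ctrees)
next
  case False
  then have "ctrees R C = {}" using ctrees_card_eq by blast
  then show ?thesis using False by auto
qed

subsection \<open>Splitting at the root\<close>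

text \<open>Disjoint line sets keep the two parts from interacting; only \<open>(r, c)\<close> adds
  relations, in column \<open>c\<close> of \<open>A\<close> and row \<open>r\<close> of
  \<open>B\<close>. It becomes the single predecessor of each subtree root, while the other points
  on these two lines already had a predecessor there.\<close>

lemma ctree_glue:
  assumes A: "ctree x c A" and B: "ctree r y B" and "r < x" "c < y"
    and disj: "fst ` A \<inter> fst ` B = {}" "snd ` A \<inter> snd ` B = {}"
  shows "ctree r c (insert (r, c) (A \<union> B))" (is "ctree r c ?U")
proof -
  note TA = ctreeD[OF A] and TB = ctreeD[OF B]
  have disj': "(u, v) \<in> B \<Longrightarrow> (u, v') \<notin> A" "(u, v) \<in> B \<Longrightarrow> (u', v) \<notin> A" for u v u' v'
    using disj by force+
  have lt: "(u, v) \<in> A \<Longrightarrow> r < u" "(u, v) \<in> B \<Longrightarrow> c < v" for u v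
    using TA(3) TB(4) assms(3,4) by force+
  have predA: "row_pred ?U u v \<noteq> col_pred ?U u v" if uv: "(u, v) \<in> A" for u v
  proof (cases "(u, v) = (x, c)")
    case True
    then have "col_pred ?U u v" using \<open>r < x\<close> by (auto simp: col_pred_def)
    moreover have "\<not> row_pred ?U u v"
      using True uv disj' TA(4) \<open>r < x\<close> by (fastforce simp: row_pred_def)
    ultimately show ?thesis by simp
  next
    case False
    have "row_pred ?U u v = row_pred A u v"
      using uv disj' lt by (fastforce simp: row_pred_def)
    moreover have "col_pred ?U u v = col_pred A u v"
    proof (cases "v = c")
      case True
      then have "x < u" using TA(3)[OF uv] False by simp
      then have "col_pred A u v" using TA(2) True by (auto simp: col_pred_def)
      then show ?thesis by (auto simp: col_pred_def)
    next
      case False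
      then show ?thesis using uv disj' by (fastforce simp: col_pred_def)
    qed
    ultimately show ?thesis using TA(5)[OF uv False] by simp
  qed
  have predB: "row_pred ?U u v \<noteq> col_pred ?U u v" if uv: "(u, v) \<in> B" for u v
  proof (cases "(u, v) = (r, y)")
    case True
    then have "row_pred ?U u v" using \<open>c < y\<close> by (auto simp: row_pred_def)
    moreover have "\<not> col_pred ?U u v"
      using True uv disj' TB(3) \<open>c < y\<close> by (fastforce simp: col_pred_def)
    ultimately show ?thesis by simp
  next
    case False
    have "col_pred ?U u v = col_pred B u v"
      using uv disj' lt by (fastforce simp: col_pred_def)
    moreover have "row_pred ?U u v = row_pred B u v"
    proof (cases "u = r")
      case True
      then have "y < v" using TB(4)[OF uv] False by simp
      then have "row_pred B u v" using TB(2) True by (auto simp: row_pred_def)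
      then show ?thesis by (auto simp: row_pred_def)
    next
      case False
      then show ?thesis using uv disj' by (fastforce simp: row_pred_def)
    qed
    ultimately show ?thesis using TB(5)[OF uv False] by simp
  qed
  have succA: "row_succ ?U u v = col_succ ?U u v" if uv: "(u, v) \<in> A" for u v
  proof -
    have "row_succ ?U u v = row_succ A u v" "col_succ ?U u v = col_succ A u v"
      using uv disj' TA(3,4)[OF uv] \<open>r < x\<close> by (fastforce simp: row_succ_def col_succ_def)+
    then show ?thesis using TA(6)[OF uv] by simp
  qed
  have succB: "row_succ ?U u v = col_succ ?U u v" if uv: "(u, v) \<in> B" for u v
  proof -
    have "row_succ ?U u v = row_succ B u v" "col_succ ?U u v = col_succ B u v"
      using uv disj' TB(3,4)[OF uv] \<open>c < y\<close> by (fastforce simp: row_succ_def col_succ_def)+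
    then show ?thesis using TB(6)[OF uv] by simp
  qed
  have "row_succ ?U r c" "col_succ ?U r c"
    using TA(2) TB(2) \<open>r < x\<close> \<open>c < y\<close> by (auto simp: row_succ_def col_succ_def)
  moreover have "r \<le> u \<and> c \<le> v" if "(u, v) \<in> ?U" for u v
    using that lt TA(4) TB(3) by (auto intro: less_imp_le)
  ultimately show ?thesis
    unfolding ctree_def using TA(1) TB(1) predA predB succA succB by auto
qed

text \<open>Uniqueness of the left subtree. Predecessors in \<open>A\<close> lead back to
  \<open>(x, c)\<close>, which lies in \<open>A'\<close> because \<open>B'\<close> avoids column
  \<open>c\<close>; going forward again, no line passes from \<open>A'\<close> to
  \<open>B'\<close>.\<close>

lemma ctree_glue_subset:
  assumes A: "ctree x c A" and "r < x"
    and eq: "insert (r, c) (A \<union> B) = insert (r, c) (A' \<union> B')"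
    and "c \<notin> snd ` B'"
    and disj: "fst ` A' \<inter> fst ` B' = {}" "snd ` A' \<inter> snd ` B' = {}"
  shows "A \<subseteq> A'"
proof -
  note T = ctreeD[OF A]
  have "(u, v) \<in> A \<Longrightarrow> (u, v) \<in> A'" for u v
  proof (induction "u + v" arbitrary: u v rule: less_induct)
    case less
    then have "u \<noteq> r" using T(3) \<open>r < x\<close> by force
    then have mem: "(u, v) \<in> A' \<or> (u, v) \<in> B'" using less.prems eq by blast
    show ?case
    proof (cases "(u, v) = (x, c)")
      case True
      then show ?thesis using mem \<open>c \<notin> snd ` B'\<close> by force
    next
      case False
      then consider v' where "v' < v" "(u, v') \<in> A" | u' where "u' < u" "(u', v) \<in> A"
        using T(5)[OF less.prems] by (auto simp: row_pred_def col_pred_def)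
      then show ?thesis
      proof cases
        case 1
        then have "(u, v') \<in> A'" using less.hyps by simp
        then show ?thesis using mem disj by force
      next
        case 2
        then have "(u', v) \<in> A'" using less.hyps by simp
        then show ?thesis using mem disj by force
      qed
    qed
  qed
  then show ?thesis by auto
qed

text \<open>The right subtree is obtained by applying this to the transposed tree.\<close>

lemma ctree_component:
  assumes A: "ctree r c A" and B: "B \<subseteq> A" "\<And>u v. (u, v) \<in> B \<Longrightarrow> u \<noteq> r"
    and row: "\<And>u v v'. (u, v) \<in> B \<Longrightarrow> (u, v') \<in> A \<Longrightarrow> (u, v') \<in> B"
    and col: "\<And>u u' v. (u, v) \<in> B \<Longrightarrow> (u', v) \<in> A \<Longrightarrow> (u', v) \<noteq> (r, c) \<Longrightarrow> (u', v) \<in> B"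
    and "(x0, c) \<in> B"
  shows "\<exists>x>r. ctree x c B"
proof -
  note T = ctreeD[OF A]
  define x where "x = (LEAST x. (x, c) \<in> B)"
  have x: "(x, c) \<in> B" and x_le: "\<And>u. (u, c) \<in> B \<Longrightarrow> x \<le> u"
    unfolding x_def using \<open>(x0, c) \<in> B\<close> by (auto intro: LeastI Least_le)
  have "r < x" using T(3) B x by (metis le_neq_implies_less subsetD)
  \<comment> \<open>Walk back along predecessors. The walk can leave \<open>B\<close> only at
    \<open>(r, c)\<close>, and the last point before that lies in column \<open>c\<close>, where
    \<open>x\<close> is least.\<close>
  have bound: "(u, v) \<in> B \<Longrightarrow> x \<le> u" for u v
  proof (induction "u + v" arbitrary: u v rule: less_induct)
    case less
    then have uv: "(u, v) \<in> A" "u \<noteq> r" using B by auto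
    then consider v' where "v' < v" "(u, v') \<in> A" | u' where "u' < u" "(u', v) \<in> A"
      using T(5)[OF uv(1)] by (auto simp: row_pred_def col_pred_def)
    then show ?case
    proof cases
      case 1
      then show ?thesis using less row[of u v v'] by auto
    next
      case 2
      show ?thesis
      proof (cases "(u', v) = (r, c)")
        case True
        then show ?thesis using x_le less.prems by simp
      next
        case False
        then show ?thesis using less.hyps[of u' v] 2 col[OF less.prems] by auto
      qed
    qed
  qed
  have succ: "row_succ B u v = col_succ B u v" if uv: "(u, v) \<in> B" for u v
  proof -
    have "(u', v) \<noteq> (r, c)" if "u' > u" for u' using T(3)[of u v] uv B(1) that by auto
    then have "row_succ B u v = row_succ A u v" "col_succ B u v = col_succ A u v"
      using row[OF uv] col[OF uv] B(1) by (auto simp: row_succ_def col_succ_def)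
    then show ?thesis using T(6) uv B(1) by auto
  qed
  have pred: "row_pred B u v \<noteq> col_pred B u v" if uv: "(u, v) \<in> B" "(u, v) \<noteq> (x, c)" for u v
  proof -
    have "row_pred B u v = row_pred A u v"
      using row[OF uv(1)] B(1) by (auto simp: row_pred_def)
    moreover have "col_pred B u v = col_pred A u v"
    \<comment> \<open>Column \<open>c\<close> loses the predecessor \<open>(r, c)\<close>, but
      \<open>(x, c)\<close> stands in for it.\<close>
    proof (cases "v = c")
      case True
      then have "x < u" using bound[OF uv(1)] uv(2) by simp
      then have "col_pred B u v" using x True by (auto simp: col_pred_def)
      then show ?thesis using B(1) by (auto simp: col_pred_def)
    next
      case False
      then show ?thesis using col[OF uv(1)] B(1) by (auto simp: col_pred_def)
    qed
    ultimately show ?thesis using T(5) uv B by auto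
  qed
  have "ctree x c B"
    unfolding ctree_def
    using finite_subset[OF B(1) T(1)] x bound T(4) B(1) pred succ by blast
  then show ?thesis using \<open>r < x\<close> by blast
qed

section \<open>The left subtree as a forward closure\<close>

text \<open>Only forward moves are allowed, which keeps row \<open>r\<close>, and with it the root
  and the right child, outside by a direct induction.\<close>

inductive_set left_part :: "nat \<Rightarrow> nat \<Rightarrow> (nat \<times> nat) set \<Rightarrow> (nat \<times> nat) set"
  for r c :: nat and A :: "(nat \<times> nat) set" where
  base: "(x, c) \<in> A \<Longrightarrow> r < x \<Longrightarrow> (x, c) \<in> left_part r c A"
| row: "(x, y) \<in> left_part r c A \<Longrightarrow> (x, y') \<in> A \<Longrightarrow> y < y' \<Longrightarrow> (x, y') \<in> left_part r c A"
| col: "(x, y) \<in> left_part r c A \<Longrightarrow> (x', y) \<in> A \<Longrightarrow> x < x' \<Longrightarrow> (x', y) \<in> left_part r c A"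

lemma left_part_subset: "(x, y) \<in> left_part r c A \<Longrightarrow> (x, y) \<in> A \<and> r < x"
  by (induction rule: left_part.induct) auto

text \<open>A vertex reached along its row has no predecessor in its column, and vice versa; hence
  the forward closure \<open>left_part\<close> is also closed under predecessors other than the root.\<close>

lemma left_part_backward:
  assumes A: "ctree r c A" and "(x, y) \<in> left_part r c A"
  shows "((x, y') \<in> A \<longrightarrow> y' < y \<longrightarrow> (x, y') \<in> left_part r c A) \<and>
    ((x', y) \<in> A \<longrightarrow> x' < x \<longrightarrow> (x', y) \<noteq> (r, c) \<longrightarrow> (x', y) \<in> left_part r c A)"
  using assms(2)
proof (induction arbitrary: x' y' rule: left_part.induct)
  case (base x)
  note T = ctreeD[OF A]
  have "\<not> row_pred A x c" using T(4) by (force simp: row_pred_def)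
  moreover have "(x', c) \<in> left_part r c A" if "(x', c) \<in> A" "(x', c) \<noteq> (r, c)"
    using that T(3)[of x' c] by (auto intro: left_part.base)
  ultimately show ?case by (auto simp: row_pred_def)
next
  case (row x y z)
  have "r < x" using left_part_subset[OF row.hyps(1)] by blast
  moreover have "row_pred A x z"
    using left_part_subset[OF row.hyps(1)] row.hyps by (auto simp: row_pred_def)
  ultimately have "\<not> col_pred A x z" using ctreeD(5)[OF A row.hyps(2)] by auto
  \<comment> \<open>Points of the row beyond \<open>(x, y)\<close> are reached forwards, those
    before it by the induction hypothesis.\<close>
  moreover have "(x, y') \<in> left_part r c A" if "(x, y') \<in> A"
    using that row.hyps row.IH left_part.row by (metis linorder_neqE_nat)
  ultimately show ?case by (auto simp: col_pred_def)
next
  case (col x y z)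
  have "r < x" using left_part_subset[OF col.hyps(1)] by blast
  moreover have "col_pred A z y"
    using left_part_subset[OF col.hyps(1)] col.hyps by (auto simp: col_pred_def)
  ultimately have "\<not> row_pred A z y" using ctreeD(5)[OF A col.hyps(2)] col.hyps(3) by auto
  moreover have "(x', y) \<in> left_part r c A" if "(x', y) \<in> A" "(x', y) \<noteq> (r, c)"
    using that col.hyps col.IH left_part.col by (metis linorder_neqE_nat)
  ultimately show ?case by (auto simp: row_pred_def)
qed

text \<open>Together with \<open>left_part_col\<close> this supplies the closure hypotheses of
  \<open>ctree_component\<close>.\<close>

lemma left_part_row:
  assumes "ctree r c A" "(x, y) \<in> left_part r c A" "(x, y') \<in> A"
  shows "(x, y') \<in> left_part r c A"
  using assms left_part_backward left_part.row by (metis linorder_neqE_nat)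

lemma left_part_col:
  assumes "ctree r c A" "(x, y) \<in> left_part r c A" "(x', y) \<in> A" "(x', y) \<noteq> (r, c)"
  shows "(x', y) \<in> left_part r c A"
  using assms left_part_backward left_part.col by (metis linorder_neqE_nat)

text \<open>Take \<open>left_part\<close> for \<open>B\<close> and the remaining non-root points for
  \<open>C\<close>. As \<open>B\<close> is saturated along lines away from the root, so is
  \<open>C\<close>, and \<open>ctree_component\<close> applies to \<open>B\<close> and to the
  transpose of \<open>C\<close>.\<close>

lemma ctree_split:
  assumes A: "ctree r c A" and "A \<noteq> {(r, c)}"
  obtains x y B C where "ctree x c B" "ctree r y C" "r < x" "c < y"
    "fst ` B \<inter> fst ` C = {}" "snd ` B \<inter> snd ` C = {}" "A = insert (r, c) (B \<union> C)"
proof -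
  note T = ctreeD[OF A]
  define B where "B = left_part r c A"
  define C where "C = A - insert (r, c) B"
  have B: "B \<subseteq> A" "\<And>u v. (u, v) \<in> B \<Longrightarrow> r < u" using left_part_subset by (auto simp: B_def)
  note row = left_part_row[OF A, folded B_def] and col = left_part_col[OF A, folded B_def]
  \<comment> \<open>A non-root point of least coordinate sum can only have the root as predecessor.
    So the root has a successor, and by completeness one of each kind.\<close>
  obtain p where p: "p \<in> A" "p \<noteq> (r, c)"
    and p_least: "\<And>q. q \<in> A \<Longrightarrow> q \<noteq> (r, c) \<Longrightarrow> fst p + snd p \<le> fst q + snd q"
    using ex_has_least_nat[of "\<lambda>p. p \<in> A \<and> p \<noteq> (r, c)" _ "\<lambda>p. fst p + snd p"] assms(2) T(2)
    by blast
  obtain u v where uv: "(u, v) \<in> A" "(u, v) \<noteq> (r, c)" and "p = (u, v)" using p by (cases p) auto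
  then have least: "u + v \<le> u' + v'" if "(u', v') \<in> A" "(u', v') \<noteq> (r, c)" for u' v'
    using p_least[of "(u', v')"] that by simp
  have "row_succ A r c \<or> col_succ A r c"
  proof -
    consider v' where "v' < v" "(u, v') \<in> A" | u' where "u' < u" "(u', v) \<in> A"
      using T(5)[OF uv] by (auto simp: row_pred_def col_pred_def)
    then show ?thesis
    proof cases
      case 1
      then have "(u, v') = (r, c)" using least[of u v'] by linarith
      then show ?thesis using 1 uv by (auto simp: row_succ_def)
    next
      case 2
      then have "(u', v) = (r, c)" using least[of u' v] by linarith
      then show ?thesis using 2 uv by (auto simp: col_succ_def)
    qed
  qed
  then have "row_succ A r c" "col_succ A r c" using T(6)[OF T(2)] by auto
  then obtain x0 y0 where x0: "(x0, c) \<in> A" "r < x0" and y0: "(r, y0) \<in> A" "c < y0"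
    by (auto simp: row_succ_def col_succ_def)
  have "(x0, c) \<in> B" using x0 by (auto simp: B_def intro: left_part.base)
  then have "\<exists>x>r. ctree x c B"
    by (rule ctree_component[OF A B(1), rotated -1]) (use B(2) row col in blast)+
  then obtain x where x: "r < x" "ctree x c B" by blast
  \<comment> \<open>Apart from the root, all of column \<open>c\<close> enters
    \<open>left_part\<close> by the base rule.\<close>
  have C_col: "v \<noteq> c" if "(u, v) \<in> C" for u v
    using that T(3)[of u v] left_part.base[of u c A r] by (auto simp: C_def B_def)
  have C_sw: "(v, u) \<in> prod.swap ` C \<longleftrightarrow> (u, v) \<in> C" "(v, u) \<in> prod.swap ` A \<longleftrightarrow> (u, v) \<in> A" for u v
    by force+
  have "\<exists>y>c. ctree y r (prod.swap ` C)"
  proof (rule ctree_component[OF ctree_swap[OF A], where ?x0.0 = y0])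
    show "prod.swap ` C \<subseteq> prod.swap ` A" by (auto simp: C_def)
    show "(y0, r) \<in> prod.swap ` C" unfolding C_sw using y0 B(2) by (auto simp: C_def)
    show "u \<noteq> c" if "(u, v) \<in> prod.swap ` C" for u v using that C_col by (auto simp: C_sw)
    show "(u, v') \<in> prod.swap ` C"
      if "(u, v) \<in> prod.swap ` C" "(u, v') \<in> prod.swap ` A" for u v v'
      using that col[of v' u v] C_col[of v u] unfolding C_sw by (auto simp: C_def)
    show "(u', v) \<in> prod.swap ` C"
      if "(u, v) \<in> prod.swap ` C" "(u', v) \<in> prod.swap ` A" "(u', v) \<noteq> (c, r)" for u u' v
      using that row[of v u' u] unfolding C_sw by (auto simp: C_def)
  qed
  then obtain y where y: "c < y" "ctree y r (prod.swap ` C)" by blast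
  then have "ctree r y C" using ctree_swap[OF y(2)] by (simp add: image_image)
  moreover have "fst ` B \<inter> fst ` C = {}" using row by (force simp: C_def)
  moreover have "snd ` B \<inter> snd ` C = {}" using col by (force simp: C_def)
  moreover have "A = insert (r, c) (B \<union> C)" using B(1) T(2) by (auto simp: C_def)
  ultimately show thesis using that x y(1) by blast
qed

section \<open>Trees on prescribed rows and columns\<close>

lemma ctrees_root:
  assumes "A \<in> ctrees (insert r R) (insert c C)" "\<And>x. x \<in> R \<Longrightarrow> r < x" "\<And>y. y \<in> C \<Longrightarrow> c < y"
  shows "ctree r c A"
proof -
  obtain r' c' where A: "ctree r' c' A" "fst ` A = insert r R" "snd ` A = insert c C"
    using assms(1) by (auto simp: ctrees_def)
  have "r' \<in> insert r R" "c' \<in> insert c C" using ctreeD(2)[OF A(1)] A(2,3) by force+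
  then have "r \<le> r'" "c \<le> c'" using assms(2,3) by (auto intro: less_imp_le)
  moreover have "r \<in> fst ` A" "c \<in> snd ` A" using A by auto
  then have "r' \<le> r" "c' \<le> c" using ctreeD(3,4)[OF A(1)] by force+
  ultimately show ?thesis using A(1) by simp
qed

text \<open>For left subtrees: the column of the root is known, its row is not.\<close>

lemma ctrees_root_col:
  assumes "A \<in> ctrees R (insert c C)" "\<And>y. y \<in> C \<Longrightarrow> c < y"
  obtains x where "ctree x c A" "x \<in> R"
proof -
  obtain x c' where A: "ctree x c' A" "fst ` A = R" "snd ` A = insert c C"
    using assms(1) by (auto simp: ctrees_def)
  have x: "x \<in> R" using ctreeD(2)[OF A(1)] A(2) by force
  have "c' \<in> insert c C" using ctreeD(2)[OF A(1)] A(3) by force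
  then have "c \<le> c'" using assms(2) by (auto intro: less_imp_le)
  moreover have "c \<in> snd ` A" using A by auto
  then have "c' \<le> c" using ctreeD(4)[OF A(1)] by force
  ultimately show thesis using A(1) x that by simp
qed

lemma ctrees_root_row:
  assumes "A \<in> ctrees (insert r R) C" "\<And>x. x \<in> R \<Longrightarrow> r < x"
  obtains y where "ctree r y A" "y \<in> C"
proof -
  obtain r' y where A: "ctree r' y A" "fst ` A = insert r R" "snd ` A = C"
    using assms(1) by (auto simp: ctrees_def)
  have y: "y \<in> C" using ctreeD(2)[OF A(1)] A(3) by force
  have "r' \<in> insert r R" using ctreeD(2)[OF A(1)] A(2) by force
  then have "r \<le> r'" using assms(2) by (auto intro: less_imp_le)
  moreover have "r \<in> fst ` A" using A by auto
  then have "r' \<le> r" using ctreeD(3)[OF A(1)] by force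
  ultimately show thesis using A(1) y that by simp
qed

text \<open>\<open>R1\<close> and \<open>C1\<close> are the lines of the left subtree other than the
  root column \<open>c\<close>; the right subtree gets the root row \<open>r\<close> and all
  remaining lines. Since \<open>R\<close> is nonempty, the tree is not a single vertex and does
  split.\<close>

lemma ctrees_bij_betw:
  assumes R: "R \<noteq> {}" "\<And>x. x \<in> R \<Longrightarrow> r < x" and C: "\<And>y. y \<in> C \<Longrightarrow> c < y"
  shows "bij_betw (\<lambda>((R1, C1), (A1, A2)). insert (r, c) (A1 \<union> A2))
    (SIGMA (R1, C1):Pow R \<times> Pow C.
       ctrees R1 (insert c C1) \<times> ctrees (insert r (R - R1)) (C - C1))
    (ctrees (insert r R) (insert c C))" (is "bij_betw ?F ?D ?S")
proof -
  have D: "\<exists>x y. ctree x c A1 \<and> ctree r y A2 \<and> r < x \<and> c < y \<and>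
      fst ` A1 \<inter> fst ` A2 = {} \<and> snd ` A1 \<inter> snd ` A2 = {} \<and>
      fst ` A1 = R1 \<and> snd ` A1 = insert c C1 \<and> R1 \<subseteq> R \<and> C1 \<subseteq> C \<and>
      fst ` A2 = insert r (R - R1) \<and> snd ` A2 = C - C1 \<and> c \<notin> C \<and> r \<notin> R"
    if "((R1, C1), (A1, A2)) \<in> ?D" for R1 C1 A1 A2
  proof -
    have *: "R1 \<subseteq> R" "C1 \<subseteq> C" "A1 \<in> ctrees R1 (insert c C1)"
      "A2 \<in> ctrees (insert r (R - R1)) (C - C1)" using that by auto
    obtain x where x: "ctree x c A1" "x \<in> R1"
      using ctrees_root_col[OF *(3)] C *(2) by (metis subsetD)
    obtain y where y: "ctree r y A2" "y \<in> C - C1"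
      using ctrees_root_row[OF *(4)] R(2) by (metis DiffD1)
    have im: "fst ` A1 = R1" "snd ` A1 = insert c C1"
      "fst ` A2 = insert r (R - R1)" "snd ` A2 = C - C1"
      using *(3,4) by (auto simp: ctrees_def)
    have "c \<notin> C" "r \<notin> R" using C R(2) by auto
    moreover have "r < x" "c < y" using x y *(1) C R(2) by auto
    moreover have "R1 \<inter> insert r (R - R1) = {}" "insert c C1 \<inter> (C - C1) = {}"
      using calculation *(1) by auto
    ultimately show ?thesis unfolding im using x(1) y(1) *(1,2) by blast
  qed
  have "inj_on ?F ?D"
  proof (rule inj_onI)
    fix p q assume pq: "p \<in> ?D" "q \<in> ?D" "?F p = ?F q"
    obtain R1 C1 A1 A2 where p: "p = ((R1, C1), (A1, A2))" by (metis surj_pair)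
    obtain S1 D1 B1 B2 where q: "q = ((S1, D1), (B1, B2))" by (metis surj_pair)
    have eq: "insert (r, c) (A1 \<union> A2) = insert (r, c) (B1 \<union> B2)" using pq(3) p q by simp
    obtain x y where P: "ctree x c A1" "ctree r y A2" "r < x" "c < y"
      "fst ` A1 \<inter> fst ` A2 = {}" "snd ` A1 \<inter> snd ` A2 = {}"
      "fst ` A1 = R1" "snd ` A1 = insert c C1" "R1 \<subseteq> R" "C1 \<subseteq> C"
      "snd ` A2 = C - C1" "c \<notin> C" "r \<notin> R"
      using D[OF pq(1)[unfolded p]] by (elim exE conjE) (rule that)
    obtain x' y' where Q: "ctree x' c B1" "ctree r y' B2" "r < x'" "c < y'"
      "fst ` B1 \<inter> fst ` B2 = {}" "snd ` B1 \<inter> snd ` B2 = {}"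
      "fst ` B1 = S1" "snd ` B1 = insert c D1" "S1 \<subseteq> R" "D1 \<subseteq> C"
      "snd ` B2 = C - D1"
      using D[OF pq(2)[unfolded q]] by (elim exE conjE) (rule that)
    \<comment> \<open>The union determines the left subtree, then the right one as the rest, and the
      index sets are read off from the lines.\<close>
    have "A1 \<subseteq> B1" using ctree_glue_subset[OF P(1,3) eq _ Q(5,6)] Q(11) P(12) by simp
    moreover have "B1 \<subseteq> A1"
      using ctree_glue_subset[OF Q(1,3) eq[symmetric] _ P(5,6)] P(11,12) by simp
    ultimately have 1: "A1 = B1" by simp
    have "A2 = insert (r, c) (A1 \<union> A2) - insert (r, c) A1" if "A1 \<inter> A2 = {}" "(r, c) \<notin> A2" for A1 A2
      using that by auto
    moreover have "A1 \<inter> A2 = {}" "B1 \<inter> B2 = {}" using P(5) Q(5) by auto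
    moreover have "c \<notin> snd ` A2" "c \<notin> snd ` B2" using P(11,12) Q(11) by simp_all
    then have "(r, c) \<notin> A2" "(r, c) \<notin> B2" by (auto simp: image_iff)
    ultimately have 2: "A2 = B2" using eq 1 by metis
    have "insert c C1 = insert c D1" using 1 P(8) Q(8) by simp
    moreover have "c \<notin> C1" "c \<notin> D1" using P(10,12) Q(10) by auto
    ultimately have "C1 = D1" by (simp add: insert_ident)
    moreover have "R1 = S1" using 1 P(7) Q(7) by simp
    ultimately show "p = q" using 1 2 p q by simp
  qed
  moreover have "?F ` ?D = ?S"
  proof (intro equalityI image_subsetI subsetI)
    fix p assume pD: "p \<in> ?D"
    obtain R1 C1 A1 A2 where p: "p = ((R1, C1), (A1, A2))" by (metis surj_pair)
    obtain x y where P: "ctree x c A1" "ctree r y A2" "r < x" "c < y"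
      "fst ` A1 \<inter> fst ` A2 = {}" "snd ` A1 \<inter> snd ` A2 = {}"
      "fst ` A1 = R1" "snd ` A1 = insert c C1" "R1 \<subseteq> R" "C1 \<subseteq> C"
      "fst ` A2 = insert r (R - R1)" "snd ` A2 = C - C1"
      using D[OF pD[unfolded p]] by (elim exE conjE) (rule that)
    have "ctree r c (?F p)" unfolding p using ctree_glue[OF P(1-6)] by simp
    moreover have "fst ` ?F p = insert r R" "snd ` ?F p = insert c C"
      using P(7-12) by (auto simp: p image_Un)
    ultimately show "?F p \<in> ?S" by (auto simp: ctrees_def)
  next
    fix A assume A: "A \<in> ?S"
    then have T: "ctree r c A" using ctrees_root R(2) C by blast
    have im: "fst ` A = insert r R" "snd ` A = insert c C" using A by (auto simp: ctrees_def)
    have rc: "r \<notin> R" "c \<notin> C" using R(2) C by auto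
    then have "A \<noteq> {(r, c)}" using im R(1) by auto
    then obtain x y A1 A2 where S: "ctree x c A1" "ctree r y A2" "r < x" "c < y"
      "fst ` A1 \<inter> fst ` A2 = {}" "snd ` A1 \<inter> snd ` A2 = {}" "A = insert (r, c) (A1 \<union> A2)"
      using ctree_split[OF T] by metis
    \<comment> \<open>Column \<open>c\<close> comes from the root and is not part of the
      index.\<close>
    let ?C1 = "snd ` A1 - {c}"
    have mem: "c \<in> snd ` A1" "r \<in> fst ` A2" using ctreeD(2)[OF S(1)] ctreeD(2)[OF S(2)] by force+
    have im': "insert r R = insert r (fst ` A1 \<union> fst ` A2)"
      "insert c C = insert c (snd ` A1 \<union> snd ` A2)" using S(7) im by (simp_all add: image_Un)
    have r1: "fst ` A1 \<subseteq> R" "insert r (R - fst ` A1) = fst ` A2"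
      using im'(1) rc(1) mem(2) S(5) by blast+
    have c1: "?C1 \<subseteq> C" "C - ?C1 = snd ` A2" "insert c ?C1 = snd ` A1"
      using im'(2) rc(2) mem(1) S(6) by blast+
    have "((fst ` A1, ?C1), (A1, A2)) \<in> ?D"
      using S(1,2) r1 c1 by (auto simp: ctrees_def)
    moreover have "A = ?F ((fst ` A1, ?C1), (A1, A2))" using S(7) by simp
    ultimately show "A \<in> ?F ` ?D" by (rule rev_image_eqI)
  qed
  ultimately show ?thesis by (simp add: bij_betw_def)
qed

subsection \<open>Counting\<close>

text \<open>Group the subsets by size.\<close>

lemma sum_Pow_card:
  fixes f :: "nat \<Rightarrow> nat"
  assumes "finite S"
  shows "(\<Sum>X\<in>Pow S. f (card X)) = (\<Sum>i\<le>card S. (card S choose i) * f i)"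
proof -
  have "(\<Sum>X\<in>Pow S. f (card X)) = (\<Sum>i\<le>card S. \<Sum>X\<in>{X \<in> Pow S. card X = i}. f (card X))"
    by (rule sum.group[symmetric]) (auto simp: assms card_mono)
  also have "\<dots> = (\<Sum>i\<le>card S. (card S choose i) * f i)"
  proof (rule sum.cong[OF refl])
    fix i
    have "{X \<in> Pow S. card X = i} = {X. X \<subseteq> S \<and> card X = i}" by auto
    then show "(\<Sum>X\<in>{X \<in> Pow S. card X = i}. f (card X)) = (card S choose i) * f i"
      using n_subsets[OF assms] by simp
  qed
  finally show ?thesis .
qed

theorem proposition9:
  fixes n :: nat
  shows "b (n + 1) =
    (\<Sum>(i, j)\<in>{(i, j). i + j = n}. (n + 1 choose i) * (n + 1 choose j) * b i * b j)"
proof -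
  let ?R = "{1..n + 1}"
  \<comment> \<open>\<open>N l i\<close> counts pairs of subtrees when the left one uses
    \<open>l\<close> rows and \<open>i\<close> columns besides column \<open>0\<close>. Balance
    forces \<open>l = i + 1\<close>; the right one then has \<open>n + 1 - i\<close> lines of each
    kind, hence \<open>n - i\<close> internal vertices.\<close>
  define N where "N l i = (if l = i + 1 then b i * b (n - i) else 0)" for l i
  have N: "card (ctrees R1 (insert 0 C1) \<times> ctrees (insert 0 (?R - R1)) (?R - C1)) =
    N (card R1) (card C1)" if "R1 \<subseteq> ?R" "C1 \<subseteq> ?R" for R1 C1
  proof -
    have fin: "finite R1" "finite C1" using that finite_subset by blast+
    have "0 \<notin> C1" "0 \<notin> ?R - R1" using that by auto
    moreover have "card R1 \<le> n + 1" "card C1 \<le> n + 1"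
      using card_mono[OF _ that(1)] card_mono[OF _ that(2)] by auto
    moreover have "card (?R - R1) = n + 1 - card R1" "card (?R - C1) = n + 1 - card C1"
      using fin that by (simp_all add: card_Diff_subset)
    ultimately show ?thesis
      using fin by (auto simp: card_cartesian_product card_ctrees N_def)
  qed
  \<comment> \<open>The only surviving index \<open>l = i + 1\<close> is within range exactly when
    \<open>i \<le> n\<close>.\<close>
  have sum_N: "(\<Sum>l\<le>n + 1. f l * N l i) = (if i \<le> n then f (i + 1) * (b i * b (n - i)) else 0)"
    for f i
  proof -
    have "(\<Sum>l\<le>n + 1. f l * N l i) =
        (\<Sum>l\<le>n + 1. if l = i + 1 then f l * (b i * b (n - i)) else 0)"
      by (rule sum.cong) (auto simp: N_def)
    then show ?thesis by (simp add: sum.delta del: sum.atMost_Suc)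
  qed
  have "{..n + 1} = insert 0 ?R" by auto
  then have "b (n + 1) = card (ctrees (insert 0 ?R) (insert 0 ?R))"
    by (simp add: b_eq_card_ctrees)
  also have "\<dots> = card (SIGMA (R1, C1):Pow ?R \<times> Pow ?R.
       ctrees R1 (insert 0 C1) \<times> ctrees (insert 0 (?R - R1)) (?R - C1))"
    by (rule bij_betw_same_card[OF ctrees_bij_betw, symmetric]) auto
  also have "\<dots> = (\<Sum>(R1, C1)\<in>Pow ?R \<times> Pow ?R.
      card (ctrees R1 (insert 0 C1) \<times> ctrees (insert 0 (?R - R1)) (?R - C1)))"
    by (subst card_SigmaI)
      (auto simp: case_prod_beta intro!: finite_ctrees finite_cartesian_product intro: finite_subset)
  also have "\<dots> = (\<Sum>(R1, C1)\<in>Pow ?R \<times> Pow ?R. N (card R1) (card C1))"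
    using N by (intro sum.cong) auto
  \<comment> \<open>Rows are summed innermost, since the number of columns admits at most one number
    of rows.\<close>
  also have "\<dots> = (\<Sum>C1\<in>Pow ?R. \<Sum>R1\<in>Pow ?R. N (card R1) (card C1))"
    by (subst sum.swap) (simp add: sum.cartesian_product)
  also have "\<dots> = (\<Sum>i\<le>n + 1. (n + 1 choose i) * (\<Sum>l\<le>n + 1. (n + 1 choose l) * N l i))"
    using sum_Pow_card[of ?R "\<lambda>l. N l _"]
      sum_Pow_card[of ?R "\<lambda>i. \<Sum>l\<le>n + 1. (n + 1 choose l) * N l i"] by simp
  also have "\<dots> = (\<Sum>i\<le>n. (n + 1 choose i) * ((n + 1 choose (i + 1)) * (b i * b (n - i))))"
    unfolding sum_N by (rule sum.mono_neutral_cong_right) auto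
  \<comment> \<open>Symmetry of binomial coefficients, as \<open>i + 1\<close> and
    \<open>n - i\<close> add up to \<open>n + 1\<close>.\<close>
  also have "\<dots> = (\<Sum>i\<le>n. (n + 1 choose i) * (n + 1 choose (n - i)) * b i * b (n - i))"
    by (intro sum.cong refl) (simp add: binomial_symmetric[of "Suc _"] del: binomial_Suc_Suc)
  also have "\<dots> = (\<Sum>(i, j)\<in>{(i, j). i + j = n}. (n + 1 choose i) * (n + 1 choose j) * b i * b j)"
    by (rule sum.reindex_bij_witness[of _ fst "\<lambda>i. (i, n - i)"]) auto
  finally show ?thesis .
qed

end
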